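(* Let $r^m_n=r^m_n(u)$, $(n,m)\in\mathbb{Z}^2$, be the octahedral functions defined in the context. For any $(n,m)\in\mathbb{Z}^2$, $r^m_n$ has the expansion $r^m_n(u)=\sum_{k=0}^\infty a_ku^k$ (near $u=0$), where $\{a_k\}_{k=0}^\infty$ satisfy, for $k\ge0$, the third-order recurrence $$(k+1)(4k-4m+3)\,a_{k+1}$$ $$+\left[k(52k-36m-168n-13)-(2m-9n)(12m+12n+1)\right]a_k$$ $$-\left[(k-1)(52k-276m-144n-65)+2(14m+3n)(12m+12n+1)\right]a_{k-1}$$ $$-(k-2m-3n-2)(4k-12m-12n-9)\,a_{k-2}=0,$$ with $a_0=1$, $a_{-1}=0$, $a_{-2}=0$. Thus when $n,m\ge0$, $r^m_n(u)$ is a degree-$(3n+2m)$ generalized Heun polynomial.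
   Context: Octahedral functions: let $p_{\rm v}(u)=u(1-u)^4$, $p_{\rm e}(u)=(1+u)(1-34u+u^2)$, $p_{\rm f}(u)=1+14u+u^2$, and $R(u)=-108\,p_{\rm v}(u)/p_{\rm e}(u)^2=1-p_{\rm f}(u)^3/p_{\rm e}(u)^2$. For $(n,m)\in\mathbb{Z}^2$, $r^m_n$ is the rational function of $u$ that on a neighborhood of $u=0$ satisfies $${}_2F_1\!\left(-\tfrac1{24}-\tfrac m2-\tfrac n2,\ \tfrac{11}{24}-\tfrac m2-\tfrac n2;\ \tfrac34-m;\ R(u)\right)=p_{\rm e}(u)^{-1/12-m-n}\,r^m_n(u)$$ (with powers of $p_{\rm e}(u)$ equal to $1$ at $u=0$), ${}_2F_1$ being the Gauss function. "Generalized Heun polynomial" means a polynomial solution of a second-order Fuchsian differential equation on the Riemann sphere with five singular points (at most); here the singular points are $u=0,\,1,\,-(2\pm\sqrt3)^2,\,\infty$. *)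

theory Defs
  imports "HOL-Analysis.Analysis"
begin

definition p_v :: "complex \<Rightarrow> complex" where
  "p_v u = u * (1 - u) ^ 4"

definition p_e :: "complex \<Rightarrow> complex" where
  "p_e u = (1 + u) * (1 - 34 * u + u ^ 2)"

definition p_f :: "complex \<Rightarrow> complex" where
  "p_f u = 1 + 14 * u + u ^ 2"

definition R_oct :: "complex \<Rightarrow> complex" where
  "R_oct u = - 108 * p_v u / p_e u ^ 2"

lemma R_oct_eq:
  assumes "p_e u \<noteq> 0"
  shows "R_oct u = 1 - p_f u ^ 3 / p_e u ^ 2"
proof -
  have "p_f u ^ 3 = p_e u ^ 2 + 108 * p_v u"
    unfolding p_v_def p_e_def p_f_def by algebra
  with assms show ?thesis
    by (simp add: R_oct_def divide_simps)
qed

(* The Gauss series. It is only used with R_oct u as argument for u near 0, where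
   R_oct u is near 0, so that no analytic continuation is involved. *)
definition gauss_2F1 :: "complex \<Rightarrow> complex \<Rightarrow> complex \<Rightarrow> complex \<Rightarrow> complex" where
  "gauss_2F1 a b c z = eval_fps (fps_hypergeo [a, b] [c] 1) z"

(* A rational function is represented by its values p u / q u in lowest terms, so it has no
   removable singularities; at a pole HOL division gives it the dummy value 0. *)
definition rational_function :: "(complex \<Rightarrow> complex) \<Rightarrow> bool" where
  "rational_function r \<longleftrightarrow>
     (\<exists>p q. q \<noteq> 0 \<and> coprime p q \<and> (\<forall>u. r u = poly p u / poly q u))"

(* r is the octahedral function with lower index n and upper index m. Since p_e 0 = 1, the
   principal branch taken by powr is the one with value 1 at u = 0. *)
definition octahedral_function :: "int \<Rightarrow> int \<Rightarrow> (complex \<Rightarrow> complex) \<Rightarrow> bool" where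
  "octahedral_function n m r \<longleftrightarrow> rational_function r \<and>
     (\<forall>\<^sub>F u in nhds 0.
        gauss_2F1 (- 1 / 24 - of_int m / 2 - of_int n / 2)
                  (11 / 24 - of_int m / 2 - of_int n / 2)
                  (3 / 4 - of_int m) (R_oct u)
        = p_e u powr (- 1 / 12 - of_int m - of_int n) * r u)"

definition pole_order_at_most :: "nat \<Rightarrow> (complex \<Rightarrow> complex) \<Rightarrow> complex \<Rightarrow> bool" where
  "pole_order_at_most j f a \<longleftrightarrow>
     (\<exists>g. g analytic_on {a} \<and> (\<forall>\<^sub>F z in at a. f z = g z / (z - a) ^ j))"

(* a is an ordinary or a regular singular point of y'' + P y' + Q y = 0. *)
definition at_most_regular_singular ::
    "(complex \<Rightarrow> complex) \<Rightarrow> (complex \<Rightarrow> complex) \<Rightarrow> complex \<Rightarrow> bool" where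
  "at_most_regular_singular P Q a \<longleftrightarrow>
     pole_order_at_most 1 P a \<and> pole_order_at_most 2 Q a"

(* y'' + P y' + Q y = 0 is Fuchsian on the Riemann sphere, with its singular points contained
   in S together with the point at infinity. Substituting z = 1/w turns the equation into
   y'' + (2/w - P(1/w)/w^2) y' + Q(1/w)/w^4 y = 0, whose point w = 0 is the point at infinity.
   The conditions force P and Q to be rational functions off S. *)
definition fuchsian_equation ::
    "complex set \<Rightarrow> (complex \<Rightarrow> complex) \<Rightarrow> (complex \<Rightarrow> complex) \<Rightarrow> bool" where
  "fuchsian_equation S P Q \<longleftrightarrow>
     finite S \<and> P analytic_on (- S) \<and> Q analytic_on (- S) \<and>
     (\<forall>a\<in>S. at_most_regular_singular P Q a) \<and>
     at_most_regular_singular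
       (\<lambda>w. 2 / w - P (1 / w) / w ^ 2) (\<lambda>w. Q (1 / w) / w ^ 4) 0"

(* With infinity, at most four finite singular points make at most five on the sphere. *)
definition generalized_Heun_polynomial :: "complex set \<Rightarrow> complex poly \<Rightarrow> bool" where
  "generalized_Heun_polynomial S y \<longleftrightarrow>
     y \<noteq> 0 \<and> card S \<le> 4 \<and>
     (\<exists>P Q. fuchsian_equation S P Q \<and>
        (\<forall>z. z \<notin> S \<longrightarrow>
           poly (pderiv (pderiv y)) z + P z * poly (pderiv y) z + Q z * poly y z = 0))"

end

theory Submission
  imports Defs "HOL-Complex_Analysis.Complex_Analysis"
    "HOL-Computational_Algebra.Fundamental_Theorem_Algebra"
begin

text \<open>
  Pulling the hypergeometric equation back along \<^term>\<open>R_oct\<close> and multiplying the solution by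
  \<open>p_e powr (1/12 + m + n)\<close> gives, after cancellation, an equation \<open>A y'' + B y' + C y = 0\<close>
  with \<open>A = 4 u (1 - u) p_f\<close> and polynomials \<open>B\<close>, \<open>C\<close> of degrees 3 and 2; comparing
  coefficients yields the recurrence. The zeros of \<open>p_e\<close> become ordinary points, and the exponents
  at \<open>0\<close>, \<open>1\<close> and at the zeros of \<open>p_f\<close> are \<open>{0, m + 1/4}\<close>, \<open>{0, 4 m + 1}\<close>, \<open>{0, 3 n + 1}\<close>.
  For \<open>n, m \<ge> 0\<close> none of them is a negative integer, so the rational solution has no poles;
  as a polynomial it has the only integral exponent at infinity, \<open>3 n + 2 m\<close>, as its degree.
\<close>

unbundle no vec_syntax
unbundle fps_syntax

section \<open>The Gauss series\<close>

text \<open>The coefficient of X^n on the left is (n+1)(c+n) F_{n+1} - (a+n)(b+n) F_n, so the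
  equation is the ratio recursion of the hypergeometric coefficients. The assumption on
  \<open>c\<close> allows the denominator of that recursion to be cleared.\<close>

lemma fps_hypergeo_2F1_ode:
  fixes a b c :: "'a :: field_char_0"
  assumes "\<And>n. c + of_nat n \<noteq> 0"
  defines "F \<equiv> fps_hypergeo [a, b] [c] 1"
  shows "fps_X * (1 - fps_X) * fps_deriv (fps_deriv F)
         + (fps_const c - (fps_const a + fps_const b + 1) * fps_X) * fps_deriv F
         - fps_const a * fps_const b * F = 0"
proof (rule fps_ext)
  fix n
  have rec: "of_nat (Suc n) * (c + of_nat n) * F $ Suc n = (a + of_nat n) * (b + of_nat n) * F $ n" for n
  proof -
    have "F $ Suc n = (a + of_nat n) * (b + of_nat n) / (of_nat (Suc n) * (c + of_nat n)) * F $ n"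
      by (simp add: F_def fps_hypergeo_rec del: of_nat_Suc fps_hypergeo_nth)
    then show ?thesis using assms(1)[of n] by (simp del: of_nat_Suc)
  qed
  have "fps_X * (1 - fps_X) * fps_deriv (fps_deriv F)
         + (fps_const c - (fps_const a + fps_const b + 1) * fps_X) * fps_deriv F
         - fps_const a * fps_const b * F
      = fps_X * fps_deriv (fps_deriv F) - fps_X * (fps_X * fps_deriv (fps_deriv F))
        + fps_const c * fps_deriv F - fps_X * (fps_const (a + b + 1) * fps_deriv F)
        - fps_const (a * b) * F"
    by (simp add: algebra_simps flip: fps_const_add fps_const_mult)
  also have "\<dots> $ n = of_nat (Suc n) * (c + of_nat n) * F $ Suc n - (a + of_nat n) * (b + of_nat n) * F $ n"
    by (cases n; cases "n - 1") (auto simp: algebra_simps)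
  finally show "(fps_X * (1 - fps_X) * fps_deriv (fps_deriv F)
         + (fps_const c - (fps_const a + fps_const b + 1) * fps_X) * fps_deriv F
         - fps_const a * fps_const b * F) $ n = 0 $ n"
    by (simp only: rec diff_self fps_zero_nth)
qed

text \<open>Iterating the bound dominates the coefficients by a geometric sequence of ratio
  \<open>L\<close>, so the series converges at the positive point 1/(2L).\<close>

lemma fps_conv_radius_pos_ratio_bound:
  fixes F :: "'a :: {banach, real_normed_div_algebra} fps"
  assumes "\<And>n. norm (F $ Suc n) \<le> K * norm (F $ n)"
  shows "fps_conv_radius F > 0"
proof -
  \<comment> \<open>The maximum keeps \<open>L\<close> positive even if \<open>K\<close> is
    not.\<close>
  define L where "L = max K 1"
  have "norm (F $ n) \<le> norm (F $ 0) * L ^ n" for n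
  proof (induction n)
    case (Suc n)
    have "norm (F $ Suc n) \<le> L * norm (F $ n)"
      using assms[of n] by (rule order_trans) (simp add: L_def mult_right_mono)
    also have "\<dots> \<le> L * (norm (F $ 0) * L ^ n)"
      using Suc by (intro mult_left_mono) (auto simp: L_def)
    finally show ?case by (simp add: mult_ac)
  qed simp
  note bound = this
  have L: "L > 0" by (simp add: L_def)
  define z :: 'a where "z = of_real (1 / (2 * L))"
  have nz: "norm z = 1 / (2 * L)" using L unfolding z_def norm_of_real by simp
  have "summable (\<lambda>n. F $ n * z ^ n)"
  proof (rule summable_comparison_test')
    show "summable (\<lambda>n. norm (F $ 0) * (1 / 2 :: real) ^ n)"
      by (intro summable_mult summable_geometric) auto
    show "norm (F $ n * z ^ n) \<le> norm (F $ 0) * (1 / 2) ^ n" if "n \<ge> 0" for n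
    proof -
      have "norm (F $ n * z ^ n) \<le> norm (F $ 0) * L ^ n * (1 / (2 * L)) ^ n"
        unfolding norm_mult norm_power nz using bound L by (intro mult_right_mono) auto
      also have "\<dots> = norm (F $ 0) * (1 / 2) ^ n"
        using L by (simp add: power_mult_distrib power_divide)
      finally show ?thesis .
    qed
  qed
  then have "conv_radius (fps_nth F) \<ge> norm z"
    by (rule conv_radius_geI)
  moreover have "(0 :: ereal) < norm z"
    using L by (simp add: nz)
  ultimately show ?thesis
    unfolding fps_conv_radius_def by (rule less_le_trans[rotated])
qed

text \<open>The coefficient ratios tend to 1, hence are bounded. Where c + n vanishes, division
  gives the ratio 0, in agreement with the coefficients, which are 0 from there on.\<close>

lemma fps_conv_radius_hypergeo_2F1_pos:
  fixes a b c :: complex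
  shows "fps_conv_radius (fps_hypergeo [a, b] [c] 1) > 0"
proof -
  let ?q = "\<lambda>n. (a + of_nat n) * (b + of_nat n) / ((c + of_nat n) * of_nat (Suc n))"
  have lin: "(\<lambda>n. (u + of_nat n) / (v + of_nat n)) \<longlonglongrightarrow> 1" for u v :: complex
  proof -
    have inv: "(\<lambda>n. inverse (v + of_nat n)) \<longlonglongrightarrow> 0"
      by (intro tendsto_inverse_0[THEN filterlim_compose] tendsto_add_filterlim_at_infinity[OF tendsto_const]
            tendsto_of_nat)
    have ev: "\<forall>\<^sub>F n in sequentially. v + of_nat n \<noteq> 0"
    proof -
      have "filterlim (\<lambda>n. v + of_nat n) at_infinity sequentially"
        by (intro tendsto_add_filterlim_at_infinity[OF tendsto_const] tendsto_of_nat)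
      then show ?thesis by (simp add: filterlim_at_infinity_imp_eventually_ne)
    qed
    \<comment> \<open>This form equals the quotient unless v + n = 0, which happens for at most one
      n.\<close>
    have "(\<lambda>n. 1 + (u - v) * inverse (v + of_nat n)) \<longlonglongrightarrow> 1 + (u - v) * 0"
      by (intro tendsto_intros inv)
    moreover have "\<forall>\<^sub>F n in sequentially.
        1 + (u - v) * inverse (v + of_nat n) = (u + of_nat n) / (v + of_nat n)"
      using ev by eventually_elim (simp add: field_simps)
    ultimately show ?thesis by (simp add: tendsto_cong)
  qed
  have "(\<lambda>n. ((a + of_nat n) / (c + of_nat n)) * ((b + of_nat n) / (1 + of_nat n))) \<longlonglongrightarrow> 1 * 1"
    by (intro tendsto_mult lin)
  then have "?q \<longlonglongrightarrow> 1" by (simp add: field_simps)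
  then have "Bseq ?q" by (intro convergent_imp_Bseq convergentI)
  then obtain K where K: "\<And>n. norm (?q n) \<le> K" using BseqE by blast
  show ?thesis
  proof (rule fps_conv_radius_pos_ratio_bound)
    fix n
    have "fps_hypergeo [a, b] [c] 1 $ Suc n = ?q n * fps_hypergeo [a, b] [c] 1 $ n"
      by (simp add: fps_hypergeo_rec mult_ac del: of_nat_Suc fps_hypergeo_nth)
    then have "norm (fps_hypergeo [a, b] [c] 1 $ Suc n) = norm (?q n) * norm (fps_hypergeo [a, b] [c] 1 $ n)"
      by (simp only: norm_mult)
    also have "\<dots> \<le> K * norm (fps_hypergeo [a, b] [c] 1 $ n)"
      by (rule mult_right_mono[OF K]) simp
    finally show "norm (fps_hypergeo [a, b] [c] 1 $ Suc n) \<le> K * norm (fps_hypergeo [a, b] [c] 1 $ n)" .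
  qed
qed

lemma gauss_2F1_has_fps_expansion:
  "gauss_2F1 a b c has_fps_expansion fps_hypergeo [a, b] [c] 1"
proof -
  have "gauss_2F1 a b c = eval_fps (fps_hypergeo [a, b] [c] 1)"
    by (simp add: fun_eq_iff gauss_2F1_def)
  then show ?thesis
    by (simp only: eval_fps_has_fps_expansion fps_conv_radius_hypergeo_2F1_pos)
qed

lemma has_fps_expansion_poly:
  "poly p has_fps_expansion fps_of_poly (p :: complex poly)"
  unfolding has_fps_expansion_def by (auto simp: fps_conv_radius_fps_of_poly)

text \<open>Logarithmic derivative of (1 + g)^c without division: the equation (1 + X) B' = c B of
  the binomial series is composed with \<open>g\<close>, and the chain rule supplies g'.\<close>

lemma fps_binomial_compose_deriv:
  fixes g :: "'a :: field_char_0 fps"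
  assumes "g $ 0 = 0"
  shows "(1 + g) * fps_deriv (fps_binomial c oo g) = fps_const c * fps_deriv g * (fps_binomial c oo g)"
proof -
  have "(1 + fps_X) * fps_deriv (fps_binomial c) = fps_const c * fps_binomial c"
    unfolding fps_binomial_deriv by (subst fps_divide_unit) (simp_all add: inverse_mult_eq_1' mult.left_commute)
  then have "((1 + fps_X) * fps_deriv (fps_binomial c)) oo g = (fps_const c * fps_binomial c) oo g"
    by simp
  then have "(1 + g) * (fps_deriv (fps_binomial c) oo g) = fps_const c * (fps_binomial c oo g)"
    using assms by (simp add: fps_compose_mult_distrib fps_compose_add_distrib)
  then show ?thesis
    unfolding fps_compose_deriv[OF assms] by algebra
qed

section \<open>Pullback of the hypergeometric equation\<close>

text \<open>The conclusion is A y'' + B y' + C y for y = H F(R), expanded by the product and chain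
  rules: \<open>F0\<close>, \<open>F1\<close>, \<open>F2\<close> stand for F, F', F'' at R, and
  \<open>H\<close> for p_e^\<beta>. It equals 4 e H R' times the hypergeometric operator at R, as
  the coefficients of \<open>F2\<close>, \<open>F1\<close> and \<open>F0\<close> show one by one.
  Each comparison is made after multiplication by a power of \<open>e\<close> and becomes polynomial
  in \<open>x\<close>; \<open>t\<close> plays 1/24, so that only ring operations occur.\<close>

lemma pullback_ode_algebra:
  fixes x t K M N H H1 H2 R R1 R2 F0 F1 F2 :: "'a :: idom"
  defines "e \<equiv> (1 + x) * (1 - 34 * x + x ^ 2)"
    and "e1 \<equiv> - 33 - 66 * x + 3 * x ^ 2" and "e2 \<equiv> 6 * x - 66"
    and "f \<equiv> 1 + 14 * x + x ^ 2"
    and "\<beta> \<equiv> 2 * t + M + N"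
    and "a \<equiv> - t - 12 * t * (M + N)" and "b \<equiv> 11 * t - 12 * t * (M + N)" and "c \<equiv> 18 * t - M"
    and "A \<equiv> 4 * x + 52 * x ^ 2 - 52 * x ^ 3 - 4 * x ^ 4"
    and "B \<equiv> (3 - 4 * M) + (39 - 36 * M - 168 * N) * x - (39 - 276 * M - 144 * N) * x ^ 2
               - (3 - 20 * M - 24 * N) * x ^ 3"
    and "C \<equiv> - (12 * M + 12 * N + 1) * ((2 * M - 9 * N) + 2 * (14 * M + 3 * N) * x
               + (2 * M + 3 * N) * x ^ 2)"
  assumes t: "24 * t = 1" and "e \<noteq> 0"
    and R: "e ^ 2 * R = - 108 * (x * (1 - x) ^ 4)"
    and R1: "e ^ 3 * R1 = - 108 * ((1 - x) ^ 3 * f ^ 2)"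
    and R2: "e ^ 3 * R2 + 3 * e ^ 2 * e1 * R1
             = - 108 * ((1 - x) ^ 2 * f * (2 * (1 - x) * (14 + 2 * x) - 3 * f))"
    and H1: "e * H1 = \<beta> * e1 * H"
    and H2: "e * H2 + e1 * H1 = \<beta> * (e2 * H + e1 * H1)"
    and ode: "R * (1 - R) * F2 + (c - (a + b + 1) * R) * F1 - a * b * F0 = 0"
  shows "A * (H2 * F0 + 2 * (H1 * (R1 * F1)) + H * (R2 * F1 + R1 * (R1 * F2)))
         + B * (H1 * F0 + H * (R1 * F1)) + C * (H * F0) = 0"
proof -
  have A: "A = 4 * (x * ((1 - x) * f))"
    unfolding A_def f_def by algebra
  have e: "e = 1 - 33 * x - 33 * x ^ 2 + x ^ 3"
    unfolding e_def by algebra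
  \<comment> \<open>This is p_e^2 + 108 p_v = p_f^3; it turns e^2 (1 - R) into f^3.\<close>
  have ef: "e ^ 2 + 108 * (x * (1 - x) ^ 4) = f ^ 3"
    unfolding e f_def by algebra
  have F2_coeff: "A * R1 = 4 * (e * (R * (1 - R)))"
  proof -
    have "e ^ 3 * (A * R1) = A * (e ^ 3 * R1)" by algebra
    also have "\<dots> = 4 * ((e ^ 2 * R) * f ^ 3)"
      unfolding R1 R A by algebra
    also have "\<dots> = 4 * ((e ^ 2 * R) * (e ^ 2 - e ^ 2 * R))"
      unfolding R ef[symmetric] by algebra
    also have "\<dots> = e ^ 3 * (4 * (e * (R * (1 - R))))" by algebra
    finally show ?thesis using \<open>e \<noteq> 0\<close> by simp
  qed
  \<comment> \<open>The comparison for \<open>F1\<close> with the common factor H * ?V * ?W of the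
    next step already removed; it determines \<open>B\<close>.\<close>
  have B: "4 * (x * (2 * \<beta> * e1 * ((1 - x) * f)
                  + e * (2 * (1 - x) * (14 + 2 * x) - 3 * f) - 3 * e1 * ((1 - x) * f))) + B * e
           = 4 * (c * e ^ 2 + 108 * ((a + b + 1) * (x * (1 - x) ^ 4)))"
    unfolding e e1_def f_def \<beta>_def a_def b_def c_def B_def using t by algebra
  have F1_coeff: "A * (2 * (H1 * R1) + H * R2) + B * (H * R1) = 4 * (e * (H * (R1 * (c - (a + b + 1) * R))))"
  proof -
    let ?W = "(1 - x) * f" and ?V = "- 108 * ((1 - x) ^ 2 * f)"
    let ?N1 = "2 * (1 - x) * (14 + 2 * x) - 3 * f"
    have "e ^ 4 * (A * (2 * (H1 * R1) + H * R2) + B * (H * R1))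
        = A * (2 * ((e * H1) * (e ^ 3 * R1))
               + H * (e * (e ^ 3 * R2 + 3 * e ^ 2 * e1 * R1) - 3 * e1 * (e ^ 3 * R1)))
          + B * (H * (e * (e ^ 3 * R1)))"
      by algebra
    also have "\<dots> = H * ?V * ?W * (4 * (x * (2 * \<beta> * e1 * ?W + e * ?N1 - 3 * e1 * ?W)) + B * e)"
      unfolding H1 R1 R2 A by algebra
    also have "\<dots> = 4 * (H * (- 108 * ((1 - x) ^ 3 * f ^ 2))
        * (c * e ^ 2 - (a + b + 1) * (- 108 * (x * (1 - x) ^ 4))))"
      unfolding B by algebra
    also have "\<dots> = e ^ 4 * (4 * (e * (H * (R1 * (c - (a + b + 1) * R)))))"
      unfolding R[symmetric] R1[symmetric] by algebra
    finally show ?thesis using \<open>e \<noteq> 0\<close> by simp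
  qed
  \<comment> \<open>The comparison for \<open>F0\<close> with H removed: the first bracket is e^2
    H''/H for H = e^\<beta>, and e \<beta> e1 is e^2 H'/H.\<close>
  have C: "A * (\<beta> * e * e2 + \<beta> * (\<beta> - 1) * e1 ^ 2) + B * e * \<beta> * e1 + C * e ^ 2
           = - 4 * (a * b * (- 108 * ((1 - x) ^ 3 * f ^ 2)))"
    unfolding e e1_def e2_def f_def \<beta>_def a_def b_def A_def B_def C_def using t by algebra
  have F0_coeff: "A * H2 + B * H1 + C * H = - 4 * (e * (a * b * (H * R1)))"
  proof -
    have "e ^ 2 * (e * H2) = e ^ 2 * (\<beta> * (e2 * H + e1 * H1) - e1 * H1)"
      using H2 by algebra
    also have "\<dots> = e * (\<beta> * e * e2 + \<beta> * (\<beta> - 1) * e1 ^ 2) * H"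
      using H1 by algebra
    finally have "e * (e ^ 2 * H2) = e * ((\<beta> * e * e2 + \<beta> * (\<beta> - 1) * e1 ^ 2) * H)"
      by algebra
    then have H2': "e ^ 2 * H2 = (\<beta> * e * e2 + \<beta> * (\<beta> - 1) * e1 ^ 2) * H"
      using \<open>e \<noteq> 0\<close> by simp
    have "e ^ 2 * (A * H2 + B * H1 + C * H) = A * (e ^ 2 * H2) + B * (e * (e * H1)) + C * e ^ 2 * H"
      by algebra
    also have "\<dots> = (A * (\<beta> * e * e2 + \<beta> * (\<beta> - 1) * e1 ^ 2) + B * e * \<beta> * e1 + C * e ^ 2) * H"
      unfolding H2' H1 by algebra
    also have "\<dots> = e ^ 2 * (- 4 * (e * (a * b * (H * R1))))"
      unfolding C R1[symmetric] by algebra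
    finally show ?thesis using \<open>e \<noteq> 0\<close> by (subst (asm) mult_left_cancel) auto
  qed
  have "A * (H2 * F0 + 2 * (H1 * (R1 * F1)) + H * (R2 * F1 + R1 * (R1 * F2)))
         + B * (H1 * F0 + H * (R1 * F1)) + C * (H * F0)
       = (A * H2 + B * H1 + C * H) * F0 + (A * (2 * (H1 * R1) + H * R2) + B * (H * R1)) * F1
         + (A * R1) * (H * (R1 * F2))"
    by algebra
  also have "\<dots> = 4 * (e * (H * (R1 *
      (R * (1 - R) * F2 + (c - (a + b + 1) * R) * F1 - a * b * F0))))"
    unfolding F0_coeff F1_coeff F2_coeff by algebra
  finally show ?thesis by (simp add: ode)
qed

text \<open>
  \<open>octahedral_ode2\<close>, \<open>octahedral_ode1 n m\<close> and \<open>octahedral_ode0 n m\<close> are \<open>A\<close>, \<open>B\<close> and \<open>C\<close>, read off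
  from the recurrence by letting \<open>k\<close> act as the Euler operator \<open>u d/du\<close>.
\<close>

definition octahedral_ode2 :: "complex poly" where
  "octahedral_ode2 = [:0, 4, 52, - 52, - 4:]"

definition octahedral_ode1 :: "int \<Rightarrow> int \<Rightarrow> complex poly" where
  "octahedral_ode1 n m = [:3 - 4 * of_int m, 39 - 36 * of_int m - 168 * of_int n,
     - (39 - 276 * of_int m - 144 * of_int n), - (3 - 20 * of_int m - 24 * of_int n):]"

definition octahedral_ode0 :: "int \<Rightarrow> int \<Rightarrow> complex poly" where
  "octahedral_ode0 n m = smult (- (12 * of_int m + 12 * of_int n + 1))
     [:2 * of_int m - 9 * of_int n, 2 * (14 * of_int m + 3 * of_int n), 2 * of_int m + 3 * of_int n:]"

section \<open>The differential equation for the power series of an octahedral function\<close>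

lemma fps_of_octahedral_ode2:
  "fps_of_poly octahedral_ode2 = 4 * fps_X + 52 * fps_X ^ 2 - 52 * fps_X ^ 3 - 4 * fps_X ^ 4"
  unfolding octahedral_ode2_def
  by (simp add: fps_of_poly_pCons algebra_simps power2_eq_square power3_eq_cube power4_eq_xxxx
        flip: numeral_fps_const)

lemma fps_of_octahedral_ode1:
  "fps_of_poly (octahedral_ode1 n m) =
     (3 - 4 * of_int m) + (39 - 36 * of_int m - 168 * of_int n) * fps_X
     - (39 - 276 * of_int m - 144 * of_int n) * fps_X ^ 2
     - (3 - 20 * of_int m - 24 * of_int n) * fps_X ^ 3"
  unfolding octahedral_ode1_def numeral_fps_const fps_of_int[symmetric]
  by (simp add: fps_of_poly_pCons algebra_simps power2_eq_square power3_eq_cube)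

lemma fps_of_octahedral_ode0:
  "fps_of_poly (octahedral_ode0 n m) =
     - (12 * of_int m + 12 * of_int n + 1) * ((2 * of_int m - 9 * of_int n)
       + 2 * (14 * of_int m + 3 * of_int n) * fps_X + (2 * of_int m + 3 * of_int n) * fps_X ^ 2)"
  unfolding octahedral_ode0_def numeral_fps_const fps_of_int[symmetric] fps_const_1_eq_1[symmetric]
  by (simp add: fps_of_poly_pCons fps_of_poly_smult algebra_simps power2_eq_square)

text \<open>The series \<open>y\<close> is that of p_e^\<beta> F(R) with \<beta> = 1/12 + m + n. It
  satisfies the pulled-back equation formally, and near 0 its function is r because the two powers
  of \<open>p_e\<close> cancel.\<close>

lemma octahedral_function_expansion:
  assumes "octahedral_function n m r"
  obtains y where "r has_fps_expansion y" and "y $ 0 = 1"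
    and "fps_of_poly octahedral_ode2 * fps_deriv (fps_deriv y)
         + fps_of_poly (octahedral_ode1 n m) * fps_deriv y
         + fps_of_poly (octahedral_ode0 n m) * y = 0"
proof -
  define a b c \<beta> :: complex where "a = - 1 / 24 - of_int m / 2 - of_int n / 2"
    and "b = 11 / 24 - of_int m / 2 - of_int n / 2" and "c = 3 / 4 - of_int m"
    and "\<beta> = 1 / 12 + of_int m + of_int n"
  define G where "G = fps_hypergeo [a, b] [c] 1"
  define e e1 e2 f v t :: "complex fps" where "e = (1 + fps_X) * (1 - 34 * fps_X + fps_X ^ 2)"
    and "e1 = - 33 - 66 * fps_X + 3 * fps_X ^ 2" and "e2 = 6 * fps_X - 66"
    and "f = 1 + 14 * fps_X + fps_X ^ 2"
    and "v = fps_X * (1 - fps_X) ^ 4" and "t = fps_const (1 / 24)"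
  define R where "R = - 108 * v * inverse (e ^ 2)"
  define F0 F1 F2 where "F0 = G oo R" and "F1 = fps_deriv G oo R"
    and "F2 = fps_deriv (fps_deriv G) oo R"
  define H where "H = fps_binomial \<beta> oo (e - 1)"
  define y where "y = H * F0"

  have e_0: "e $ 0 = 1" by (simp add: e_def)
  then have "e \<noteq> 0" by auto
  have R_0: "R $ 0 = 0" by (simp add: R_def v_def)
  have t: "24 * t = 1" by (simp add: t_def numeral_fps_const)
  \<comment> \<open>4 (c + k) = 3 - 4 m + 4 k is an odd integer.\<close>
  have "c + of_nat k \<noteq> 0" for k
  proof
    assume "c + of_nat k = 0"
    then have "(of_int (3 - 4 * m + 4 * int k) :: complex) = 0"
      by (simp add: c_def field_simps)
    then have "3 - 4 * m + 4 * int k = 0" by (simp only: of_int_eq_0_iff)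
    then show False by presburger
  qed
  note G_ode = fps_hypergeo_2F1_ode[OF this, of a b, folded G_def]
  have R: "e ^ 2 * R = - 108 * (fps_X * (1 - fps_X) ^ 4)"
    using inverse_mult_eq_1'[of "e ^ 2"] e_0
    by (simp add: R_def v_def algebra_simps fps_power_zeroth)
  have e': "fps_deriv e = e1"
    unfolding e_def e1_def power2_eq_square by (simp add: algebra_simps)
  have e1': "fps_deriv e1 = e2"
    unfolding e1_def e2_def power2_eq_square by simp
  have f': "fps_deriv f = 14 + 2 * fps_X"
    unfolding f_def power2_eq_square by simp
  have R1: "e ^ 3 * fps_deriv R = - 108 * ((1 - fps_X) ^ 3 * f ^ 2)"
  proof -
    \<comment> \<open>Differentiating e^2 R and then e^3 R' avoids the derivative of an inverse;
      powers are spelled out as products for the Leibniz rule.\<close>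
    have "fps_deriv (e * (e * R)) =
        fps_deriv (- 108 * (fps_X * ((1 - fps_X) * ((1 - fps_X) * ((1 - fps_X) * (1 - fps_X))))))"
      using R by (simp add: power2_eq_square power4_eq_xxxx mult_ac)
    then have "e1 * (e * R) + e * (e1 * R + e * fps_deriv R)
        = - 108 * ((1 - fps_X) ^ 4 - 4 * fps_X * (1 - fps_X) ^ 3)"
      by (simp add: e') algebra
    then have "e ^ 3 * fps_deriv R
        = e * (- 108 * ((1 - fps_X) ^ 4 - 4 * fps_X * (1 - fps_X) ^ 3)) - 2 * e1 * (e ^ 2 * R)"
      by algebra
    also have "\<dots> = - 108 * ((1 - fps_X) ^ 3 * f ^ 2)"
      unfolding R unfolding e_def e1_def f_def by algebra
    finally show ?thesis .
  qed
  have R2: "e ^ 3 * fps_deriv (fps_deriv R) + 3 * e ^ 2 * e1 * fps_deriv R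
      = - 108 * ((1 - fps_X) ^ 2 * f * (2 * (1 - fps_X) * (14 + 2 * fps_X) - 3 * f))"
  proof -
    have "e ^ 3 * fps_deriv (fps_deriv R) + 3 * e ^ 2 * e1 * fps_deriv R
        = fps_deriv (e * (e * (e * fps_deriv R)))"
      by (simp add: e') algebra
    also have "\<dots> = fps_deriv (- 108 * ((1 - fps_X) * ((1 - fps_X) * (1 - fps_X)) * (f * f)))"
      using R1 by (simp add: power2_eq_square power3_eq_cube mult_ac)
    also have "\<dots> = - 108 * ((1 - fps_X) ^ 2 * f * (2 * (1 - fps_X) * (14 + 2 * fps_X) - 3 * f))"
      by (simp add: f') algebra
    finally show ?thesis .
  qed
  have H1: "e * fps_deriv H = fps_const \<beta> * e1 * H"
    using fps_binomial_compose_deriv[of "e - 1" \<beta>] e_0 by (simp add: H_def e')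
  have H2: "e * fps_deriv (fps_deriv H) + e1 * fps_deriv H
      = fps_const \<beta> * (e2 * H + e1 * fps_deriv H)"
    using arg_cong[OF H1, of fps_deriv] by (simp add: e' e1' algebra_simps)
  have F0': "fps_deriv F0 = fps_deriv R * F1" and F1': "fps_deriv F1 = fps_deriv R * F2"
    by (simp_all add: F0_def F1_def F2_def fps_compose_deriv[OF R_0] mult.commute)
  have F_ode: "R * (1 - R) * F2 + (fps_const c - (fps_const a + fps_const b + 1) * R) * F1
      - fps_const a * fps_const b * F0 = 0"
    \<comment> \<open>Since R has constant term 0, composition with R is a ring
      homomorphism.\<close>
    using arg_cong[OF G_ode, of "\<lambda>g. g oo R"] R_0
    by (simp add: F0_def F1_def F2_def fps_compose_mult_distrib fps_compose_add_distrib
          fps_compose_sub_distrib del: fps_const_add fps_const_mult)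
  have const_eqs: "fps_const \<beta> = 2 * t + of_int m + of_int n"
    "fps_const a = - t - 12 * t * (of_int m + of_int n)"
    "fps_const b = 11 * t - 12 * t * (of_int m + of_int n)"
    "fps_const c = 18 * t - of_int m"
    unfolding t_def numeral_fps_const fps_of_int[symmetric] a_def b_def c_def \<beta>_def
    by (simp_all add: field_simps)
  have y': "fps_deriv y = fps_deriv H * F0 + H * (fps_deriv R * F1)"
    by (simp add: y_def F0' algebra_simps)
  have y'': "fps_deriv (fps_deriv y) = fps_deriv (fps_deriv H) * F0 + 2 * (fps_deriv H * (fps_deriv R * F1))
      + H * (fps_deriv (fps_deriv R) * F1 + fps_deriv R * (fps_deriv R * F2))"
    by (simp add: y' F0' F1' algebra_simps)
  have y_ode: "fps_of_poly octahedral_ode2 * fps_deriv (fps_deriv y)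
         + fps_of_poly (octahedral_ode1 n m) * fps_deriv y
         + fps_of_poly (octahedral_ode0 n m) * y = 0"
    unfolding fps_of_octahedral_ode2 fps_of_octahedral_ode1 fps_of_octahedral_ode0 y''
    unfolding y' unfolding y_def
    by (rule pullback_ode_algebra[OF t])
       (use \<open>e \<noteq> 0\<close> R R1 R2 H1 H2 F_ode in
         \<open>simp_all only: const_eqs e_def e1_def e2_def f_def not_False_eq_True\<close>)

  have e_exp: "p_e has_fps_expansion e"
    unfolding p_e_def[abs_def] e_def by (intro fps_expansion_intros)
  have "p_v has_fps_expansion v"
    unfolding p_v_def[abs_def] v_def by (intro fps_expansion_intros)
  then have "(\<lambda>u. - 108 * p_v u * inverse (p_e u ^ 2)) has_fps_expansion R"
    unfolding R_def using e_exp by (intro fps_expansion_intros) (simp_all add: e_0 fps_power_zeroth)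
  then have "R_oct has_fps_expansion R"
    by (simp add: R_oct_def[abs_def] divide_inverse)
  then have F0_exp: "(gauss_2F1 a b c \<circ> R_oct) has_fps_expansion F0"
    unfolding F0_def G_def
    by (intro has_fps_expansion_compose gauss_2F1_has_fps_expansion R_0)
  \<comment> \<open>p_e takes the value 1 at 0, so the principal branch of the power is the binomial
    series in p_e - 1.\<close>
  have "((\<lambda>x. (1 + x) powr \<beta>) \<circ> (\<lambda>u. p_e u - 1)) has_fps_expansion H"
    unfolding H_def using e_exp
    by (intro has_fps_expansion_compose fps_expansion_intros) (simp_all add: e_0)
  then have "(\<lambda>u. p_e u powr \<beta>) has_fps_expansion H"
    by (simp add: o_def)
  from has_fps_expansion_mult[OF this F0_exp]
  have y_exp: "(\<lambda>u. p_e u powr \<beta> * gauss_2F1 a b c (R_oct u)) has_fps_expansion y"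
    by (simp add: y_def)
  have "continuous (at 0) p_e"
    using e_exp by (rule has_fps_expansion_imp_continuous)
  then have "(p_e \<longlongrightarrow> p_e 0) (nhds 0)"
    by (simp add: continuous_at tendsto_at_iff_tendsto_nhds)
  then have "\<forall>\<^sub>F u in nhds 0. p_e u \<noteq> 0"
    by (rule tendsto_imp_eventually_ne) (simp add: p_e_def)
  moreover have "\<forall>\<^sub>F u in nhds 0. gauss_2F1 a b c (R_oct u)
      = p_e u powr (- 1 / 12 - of_int m - of_int n) * r u"
    using assms by (simp add: octahedral_function_def a_def b_def c_def)
  ultimately have r_eq: "\<forall>\<^sub>F u in nhds 0. p_e u powr \<beta> * gauss_2F1 a b c (R_oct u) = r u"
  proof eventually_elim
    case (elim u)
    then have "p_e u powr \<beta> * gauss_2F1 a b c (R_oct u) = (p_e u powr \<beta> * p_e u powr (- \<beta>)) * r u"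
      by (simp add: \<beta>_def)
    with elim show ?case by (simp flip: powr_add)
  qed
  have "r has_fps_expansion y"
    using y_exp has_fps_expansion_cong[OF r_eq refl, of y] by simp
  moreover have "y $ 0 = 1"
    by (simp add: y_def F0_def G_def H_def)
  ultimately show ?thesis using y_ode that by blast
qed

section \<open>From the differential equation to the recurrence\<close>

lemma octahedral_ode_recurrence:
  fixes y :: "complex fps"
  assumes ode: "fps_of_poly octahedral_ode2 * fps_deriv (fps_deriv y)
         + fps_of_poly (octahedral_ode1 n m) * fps_deriv y
         + fps_of_poly (octahedral_ode0 n m) * y = 0"
    and "k \<ge> 0"
  defines "a \<equiv> \<lambda>k. if k < 0 then 0 else fps_nth y (nat k)"
  shows "of_int ((k + 1) * (4 * k - 4 * m + 3)) * a (k + 1)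
      + of_int (k * (52 * k - 36 * m - 168 * n - 13)
                - (2 * m - 9 * n) * (12 * m + 12 * n + 1)) * a k
      - of_int ((k - 1) * (52 * k - 276 * m - 144 * n - 65)
                + 2 * (14 * m + 3 * n) * (12 * m + 12 * n + 1)) * a (k - 1)
      - of_int ((k - 2 * m - 3 * n - 2) * (4 * k - 12 * m - 12 * n - 9)) * a (k - 2)
      = 0" (is "?rec k = 0")
proof -
  obtain j where k: "k = int j" using \<open>k \<ge> 0\<close> nonneg_eq_int by blast
  define M N L :: complex where "M = of_int m" and "N = of_int n" and "L = 12 * M + 12 * N + 1"
  let ?y' = "fps_deriv y" and ?y'' = "fps_deriv (fps_deriv y)"
  have S: "fps_of_poly octahedral_ode2 * ?y'' + fps_of_poly (octahedral_ode1 n m) * ?y'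
         + fps_of_poly (octahedral_ode0 n m) * y
      = fps_const 4 * (fps_X ^ 1 * ?y'') + fps_const 52 * (fps_X ^ 2 * ?y'')
        - fps_const 52 * (fps_X ^ 3 * ?y'') - fps_const 4 * (fps_X ^ 4 * ?y'')
        + fps_const (3 - 4 * M) * ?y' + fps_const (39 - 36 * M - 168 * N) * (fps_X ^ 1 * ?y')
        - fps_const (39 - 276 * M - 144 * N) * (fps_X ^ 2 * ?y')
        - fps_const (3 - 20 * M - 24 * N) * (fps_X ^ 3 * ?y')
        - fps_const (L * (2 * M - 9 * N)) * y
        - fps_const (2 * L * (14 * M + 3 * N)) * (fps_X ^ 1 * y)
        - fps_const (L * (2 * M + 3 * N)) * (fps_X ^ 2 * y)" (is "_ = ?S")
    unfolding fps_of_octahedral_ode0 fps_of_octahedral_ode1 fps_of_octahedral_ode2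
    unfolding M_def N_def L_def fps_const_add[symmetric] fps_const_mult[symmetric] fps_const_sub[symmetric]
      numeral_fps_const[symmetric] fps_const_1_eq_1 fps_of_int
    by algebra
  \<comment> \<open>The recurrence at k is the coefficient of X^k in the equation; terms with a
    negative index vanish by the definition of \<open>a\<close>.\<close>
  have "fps_nth ?S j = ?rec k"
  proof -
    have a: "a (k + 1) = fps_nth y (Suc j)" "a k = fps_nth y j"
      "a (k - 1) = (if j < 1 then 0 else fps_nth y (j - 1))"
      "a (k - 2) = (if j < 2 then 0 else fps_nth y (j - 2))"
      by (auto simp: a_def k nat_add_distrib nat_diff_distrib)
    note nths = a fps_add_nth fps_sub_nth fps_mult_left_const_nth fps_X_power_mult_nth fps_deriv_nth
    \<comment> \<open>The largest shift is X^4, so from j = 4 on every subtraction of indices is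
      exact; the smaller cases involve truncation and are checked singly.\<close>
    have "(j = 0 \<or> j = Suc 0 \<or> j = Suc (Suc 0) \<or> j = Suc (Suc (Suc 0)))
        \<or> (\<exists>i. j = Suc (Suc (Suc (Suc i))))"
      by presburger
    then consider "j = 0 \<or> j = Suc 0 \<or> j = Suc (Suc 0) \<or> j = Suc (Suc (Suc 0))"
      | i where "j = Suc (Suc (Suc (Suc i)))"
      by blast
    then show ?thesis
    proof cases
      case 1
      then show ?thesis
        unfolding nths unfolding k M_def N_def L_def
        by (elim disjE) (simp_all add: algebra_simps)
    next
      case (2 i)
      define x y2 y3 y4 y5 where "x = (of_nat i :: complex)" and "y2 = fps_nth y (Suc (Suc i))"
        and "y3 = fps_nth y (Suc (Suc (Suc i)))" and "y4 = fps_nth y (Suc (Suc (Suc (Suc i))))"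
        and "y5 = fps_nth y (Suc (Suc (Suc (Suc (Suc i)))))"
      show ?thesis
        unfolding nths unfolding k 2 L_def
        by (simp flip: M_def N_def x_def y2_def y3_def y4_def y5_def) algebra
    qed
  qed
  then show ?thesis
    unfolding S[symmetric] ode fps_zero_nth by (rule sym)
qed

section \<open>Rational solutions and singular points\<close>

text \<open>
  The hypothesis is the equation \<open>A y'' + B y' + C y = 0\<close> for \<open>y = p / q\<close>, multiplied by \<open>q ^ 3\<close>.
  The conclusion says that \<open>- d\<close>, for a pole of order \<open>d\<close>, is a root of the indicial equation.
\<close>

lemma rational_solution_pole:
  fixes A B C p q :: "'a :: field_char_0 poly"
  assumes ode: "A * (pderiv (pderiv p) * q ^ 2 - 2 * pderiv p * pderiv q * q - p * q * pderiv (pderiv q)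
                     + 2 * p * pderiv q ^ 2)
                + B * (q * (pderiv p * q - p * pderiv q)) + C * (p * q ^ 2) = 0"
    and "coprime p q" "q \<noteq> 0" "poly q z = 0"
  obtains d where "d > 0" "poly A z = 0" "poly B z = of_nat (d + 1) * poly (pderiv A) z"
proof -
  obtain e s where q: "q = [:- z, 1:] ^ Suc e * s" and s: "poly s z \<noteq> 0"
  proof -
    have "order z q \<noteq> 0" using assms(3,4) by (simp add: order_root)
    then obtain e where "order z q = Suc e" using not0_implies_Suc by blast
    with order_decomp[OF \<open>q \<noteq> 0\<close>, of z] show ?thesis
      using that by (auto simp: poly_eq_0_iff_dvd)
  qed
  have p: "poly p z \<noteq> 0"
    using \<open>coprime p q\<close> \<open>poly q z = 0\<close> coprime_poly_0 by blast
  define l where "l = [:- z, 1:]"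
  have l': "pderiv l = 1" and l: "poly l z = 0" and "l \<noteq> 0" by (simp_all add: l_def pderiv_pCons)
  define v where "v = of_nat (Suc e) * s + l * pderiv s"
  have q: "q = l ^ e * (l * s)" using q unfolding l_def power_Suc by (simp only: mult_ac)
  \<comment> \<open>The extra factor \<open>l\<close> avoids the truncated exponent e - 1 when e =
    0.\<close>
  have ple: "l * pderiv (l ^ e) = of_nat e * l ^ e"
    by (cases e) (simp_all add: pderiv_power_Suc l' of_nat_poly del: of_nat_Suc power_Suc, simp)
  have q': "pderiv q = l ^ e * v"
  proof -
    have "pderiv q = (l * pderiv (l ^ e)) * s + l ^ e * (s + l * pderiv s)"
      unfolding q pderiv_mult l' by (simp add: algebra_simps)
    then show ?thesis
      unfolding ple v_def by (simp add: algebra_simps)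
  qed
  have q'': "l * pderiv (pderiv q) = l ^ e * (of_nat e * v + l * pderiv v)"
  proof -
    have "l * pderiv (pderiv q) = (l * pderiv (l ^ e)) * v + l ^ e * (l * pderiv v)"
      unfolding q' pderiv_mult by (simp add: algebra_simps)
    then show ?thesis
      unfolding ple by (simp add: algebra_simps)
  qed
  \<comment> \<open>\<open>T\<close> and l * U are the numerators of y'' and y' freed of the common
    factor l^(2e); the pole has order e + 1.\<close>
  define T where "T = l ^ 2 * s ^ 2 * pderiv (pderiv p) - 2 * l * pderiv p * v * s
      - p * s * (of_nat e * v + l * pderiv v) + 2 * p * v ^ 2"
  define U where "U = s * (pderiv p * l * s - p * v)"
  have "(l ^ e) ^ 2 * l * (A * T + B * (l * U) + C * (l ^ 2 * p * s ^ 2))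
     = A * (l * pderiv (pderiv p) * q ^ 2 - 2 * l * pderiv p * pderiv q * q - p * q * (l * pderiv (pderiv q))
                     + 2 * l * p * pderiv q ^ 2)
                + l * B * (q * (pderiv p * q - p * pderiv q)) + l * C * (p * q ^ 2)"
    unfolding q'' unfolding q' unfolding q T_def U_def by algebra
  also have "\<dots> = l * 0"
    unfolding ode[symmetric] by algebra
  finally have TU: "A * T + B * (l * U) + C * (l ^ 2 * p * s ^ 2) = 0"
    using \<open>l \<noteq> 0\<close> by simp
  have v: "poly v z = of_nat (Suc e) * poly s z"
    by (simp add: v_def l)
  \<comment> \<open>With d = e + 1 the factor is d (d + 1) = (-d)(-d - 1), the one produced by
    differentiating (u - z)^(-d) twice. It is nonzero in characteristic 0, which forces A(z) =
    0.\<close>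
  have Tz: "poly T z = of_nat (Suc e) * of_nat (Suc (Suc e)) * (poly p z * poly s z ^ 2)"
    by (simp add: T_def l v power2_eq_square algebra_simps)
  have "poly A z * poly T z = 0"
    using arg_cong[OF TU, of "\<lambda>g. poly g z"] by (simp add: l)
  then have Az: "poly A z = 0"
    using p s by (simp add: Tz del: of_nat_Suc)
  then obtain A1 where A1: "A = l * A1"
    unfolding l_def by (auto simp: poly_eq_0_iff_dvd)
  \<comment> \<open>Dividing by \<open>l\<close> once more exposes the next order, where U(z) = -d
    p(z) s(z)^2; this yields the indicial equation.\<close>
  have "l * (A1 * T + B * U + C * (l * p * s ^ 2)) = 0"
    using TU unfolding A1 by algebra
  then have "A1 * T + B * U + C * (l * p * s ^ 2) = 0"
    using \<open>l \<noteq> 0\<close> by simp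
  from arg_cong[OF this, of "\<lambda>g. poly g z"]
  have "poly A1 z * poly T z = poly B z * of_nat (Suc e) * (poly p z * poly s z ^ 2)"
    by (simp add: l U_def v power2_eq_square algebra_simps del: of_nat_Suc)
  then have "poly B z = of_nat (Suc (Suc e)) * poly A1 z"
    using p s by (simp add: Tz mult.commute[of "poly A1 z"] del: of_nat_Suc)
  moreover have "poly (pderiv A) z = poly A1 z"
    by (simp add: A1 pderiv_mult l' l)
  ultimately show ?thesis
    using that[of "Suc e"] Az by simp
qed

text \<open>Substituting p = q y and its derivatives turns the left side into q^3 (A y'' + B y' + C
  y), and polynomials embed injectively into power series.\<close>

lemma fps_quotient_ode:
  fixes A B C p q :: "'a :: field_char_0 poly" and y :: "'a fps"
  assumes "fps_of_poly A * fps_deriv (fps_deriv y) + fps_of_poly B * fps_deriv y + fps_of_poly C * y = 0"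
    and q: "fps_of_poly p = fps_of_poly q * y"
  shows "A * (pderiv (pderiv p) * q ^ 2 - 2 * pderiv p * pderiv q * q - p * q * pderiv (pderiv q)
                     + 2 * p * pderiv q ^ 2)
                + B * (q * (pderiv p * q - p * pderiv q)) + C * (p * q ^ 2) = 0"
    (is "?lhs = 0")
proof -
  have q': "fps_deriv (fps_of_poly p) = fps_deriv (fps_of_poly q) * y + fps_of_poly q * fps_deriv y"
    unfolding q by simp
  have q'': "fps_deriv (fps_deriv (fps_of_poly p)) = fps_deriv (fps_deriv (fps_of_poly q)) * y
      + 2 * (fps_deriv (fps_of_poly q) * fps_deriv y) + fps_of_poly q * fps_deriv (fps_deriv y)"
    unfolding q' by simp
  have "fps_of_poly ?lhs = fps_of_poly q ^ 3 *
     (fps_of_poly A * fps_deriv (fps_deriv y) + fps_of_poly B * fps_deriv y + fps_of_poly C * y)"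
    unfolding fps_of_poly_simps fps_of_poly_pderiv fps_of_poly_numeral q'' unfolding q' unfolding q
    by algebra
  also have "\<dots> = fps_of_poly 0"
    by (simp add: assms(1))
  finally show ?thesis by (simp only: fps_of_poly_eq_iff)
qed

text \<open>The quotient B/A' is 3/4 - m at 0, -4 m at 1 and -3 n at the zeros of
  \<open>p_f\<close>. For n, m \<ge> 0 none of these is a positive integer d + 1.\<close>

lemma octahedral_ode_no_pole:
  fixes n m :: int
  assumes "n \<ge> 0" "m \<ge> 0" "poly octahedral_ode2 z = 0"
  shows "poly (octahedral_ode1 n m) z \<noteq> of_nat (d + 1) * poly (pderiv octahedral_ode2) z"
proof
  assume B: "poly (octahedral_ode1 n m) z = of_nat (d + 1) * poly (pderiv octahedral_ode2) z"
  have A': "poly (pderiv octahedral_ode2) z = 4 + 104 * z - 156 * z ^ 2 - 16 * z ^ 3"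
    by (simp add: octahedral_ode2_def pderiv_pCons power2_eq_square power3_eq_cube algebra_simps)
  have "4 * z * (1 - z) * (1 + 14 * z + z ^ 2) = 0"
    using assms(3) by (simp add: octahedral_ode2_def power2_eq_square algebra_simps)
  then consider "z = 0" | "z = 1" | "1 + 14 * z + z ^ 2 = 0"
    unfolding mult_eq_0_iff by auto
  then show False
  proof cases
    case 1
    then have "(of_int (3 - 4 * m) :: complex) = of_int (4 * (int d + 1))"
      using B unfolding A' by (simp add: octahedral_ode1_def)
    then have "3 - 4 * m = 4 * (int d + 1)" by (simp only: of_int_eq_iff)
    then show False by presburger
  next
    case 2
    then have "(of_int (256 * m) :: complex) = of_int (- 64 * (int d + 1))"
      using B unfolding A' by (simp add: octahedral_ode1_def algebra_simps)
    then have "256 * m = - 64 * (int d + 1)" by (simp only: of_int_eq_iff)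
    then show False using assms by simp
  next
    case 3
    txt \<open>Modulo \<open>p_f\<close>, the polynomial \<open>B\<close> is \<open>- 3 n A'\<close>.\<close>
    have B': "poly (octahedral_ode1 n m) z = - 3 * of_int n * poly (pderiv octahedral_ode2) z"
      using 3 unfolding A' octahedral_ode1_def by simp algebra
    have "poly (pderiv octahedral_ode2) z \<noteq> 0"
    proof
      assume "poly (pderiv octahedral_ode2) z = 0"
      \<comment> \<open>The zeros of \<open>p_f\<close> are simple zeros of
        \<open>octahedral_ode2\<close>, so 1 lies in the ideal generated by \<open>p_f\<close> and
        A'.\<close>
      then have "(1::complex) = 0" using 3 unfolding A' by algebra
      then show False by simp
    qed
    moreover have "of_int (- 3 * n) * poly (pderiv octahedral_ode2) z
        = of_int (int d + 1) * poly (pderiv octahedral_ode2) z"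
      using trans[OF B'[symmetric] B] by simp
    ultimately have "(of_int (- 3 * n) :: complex) = of_int (int d + 1)"
      using mult_right_cancel by blast
    then have "- 3 * n = int d + 1" by (simp only: of_int_eq_iff)
    then show False using assms by simp
  qed
qed

lemma poly_analytic_on [analytic_intros]:
  fixes p :: "complex poly"
  shows "poly p analytic_on S"
proof -
  have "poly p = (\<lambda>z. \<Sum>i\<le>degree p. coeff p i * z ^ i)"
    by (simp add: fun_eq_iff poly_altdef)
  then show ?thesis by (simp only:) (intro analytic_intros)
qed

lemma poly_altdef_degree_le:
  fixes p :: "'a :: comm_semiring_1 poly"
  assumes "degree p \<le> d"
  shows "poly p z = (\<Sum>i\<le>d. coeff p i * z ^ i)"
  unfolding poly_altdef using assms by (intro sum.mono_neutral_left) (auto simp: coeff_eq_0)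

text \<open>In lowest terms p / q, a zero of q would be a pole whose order contradicts the indicial
  equation. Hence q has no zeros and is constant.\<close>

lemma octahedral_function_polynomial:
  assumes "octahedral_function n m r" and "n \<ge> 0" "m \<ge> 0"
  obtains p where "\<And>u. r u = poly p u"
proof -
  obtain y where y: "r has_fps_expansion y" "y $ 0 = 1"
    and ode: "fps_of_poly octahedral_ode2 * fps_deriv (fps_deriv y)
         + fps_of_poly (octahedral_ode1 n m) * fps_deriv y
         + fps_of_poly (octahedral_ode0 n m) * y = 0"
    using octahedral_function_expansion[OF assms(1)] by blast
  obtain p q where q: "q \<noteq> 0" and pq: "coprime p q" and r: "\<And>u. r u = poly p u / poly q u"
    using assms(1) unfolding octahedral_function_def rational_function_def by blast
  have "r 0 = 1"
    using has_fps_expansion_imp_0_eq_fps_nth_0[OF y(1)] y(2) by simp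
  \<comment> \<open>If q vanished at 0, division by zero would make r 0 equal to 0 instead of
    1.\<close>
  then have "poly q 0 \<noteq> 0"
    using r[of 0] by auto
  moreover have "(poly q \<longlongrightarrow> poly q 0) (nhds 0)"
    using poly_isCont[of 0 q] by (simp add: continuous_at tendsto_at_iff_tendsto_nhds)
  ultimately have "\<forall>\<^sub>F u in nhds 0. poly q u \<noteq> 0"
    using tendsto_imp_eventually_ne by blast
  then have ev: "\<forall>\<^sub>F u in nhds 0. poly q u * r u = poly p u"
    by eventually_elim (simp add: r)
  have "(\<lambda>u. poly q u * r u) has_fps_expansion fps_of_poly q * y"
    by (intro has_fps_expansion_mult has_fps_expansion_poly y)
  then have "poly p has_fps_expansion fps_of_poly q * y"
    using has_fps_expansion_cong[OF ev refl] by blast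
  then have "fps_of_poly p = fps_of_poly q * y"
    using has_fps_expansion_poly fps_expansion_unique_complex by blast
  note pq_ode = fps_quotient_ode[OF ode this]
  have "poly q z \<noteq> 0" for z
  proof
    assume "poly q z = 0"
    from rational_solution_pole[OF pq_ode pq q this]
    obtain d where "d > 0" "poly octahedral_ode2 z = 0"
      "poly (octahedral_ode1 n m) z = of_nat (d + 1) * poly (pderiv octahedral_ode2) z" .
    with octahedral_ode_no_pole[OF assms(2,3)] show False by blast
  qed
  then have "degree q = 0"
    using Fundamental_Theorem_Algebra.fundamental_theorem_of_algebra[of q]
    by (auto simp: constant_degree)
  then obtain c where "q = [:c:]"
    by (rule degree_eq_zeroE)
  then have "r u = poly (smult (1 / c) p) u" for u
    by (simp add: r)
  then show ?thesis using that by blast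
qed

section \<open>The Fuchsian property\<close>

lemma at_most_regular_singularI:
  assumes "p analytic_on {a}" "q analytic_on {a}" "A analytic_on {a}" "A a \<noteq> 0"
    and "\<forall>\<^sub>F z in at a. P z = p z / (A z * (z - a))"
    and "\<forall>\<^sub>F z in at a. Q z = q z / (A z * (z - a) ^ 2)"
  shows "at_most_regular_singular P Q a"
  unfolding at_most_regular_singular_def pole_order_at_most_def
proof (intro conjI exI)
  show "(\<lambda>z. p z / A z) analytic_on {a}" "(\<lambda>z. q z / A z) analytic_on {a}"
    using assms(1-4) by (auto intro!: analytic_intros)
qed (use assms(5,6) in \<open>simp_all add: divide_divide_eq_left\<close>)

text \<open>At the four simple zeros of \<open>A\<close> both coefficients have at most simple
  poles. The bounds 3 and 2 on the degrees, against degree 4 of \<open>A\<close>, make infinity at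
  most a regular singular point.\<close>

lemma fuchsian_equation_roots:
  fixes a b c d :: complex and A B C :: "complex poly"
  assumes A: "A = smult k ([:- a, 1:] * [:- b, 1:] * [:- c, 1:] * [:- d, 1:])"
    and "k \<noteq> 0" "distinct [a, b, c, d]" "degree B \<le> 3" "degree C \<le> 2"
  shows "fuchsian_equation {a, b, c, d} (\<lambda>z. poly B z / poly A z) (\<lambda>z. poly C z / poly A z)"
proof -
  have poly_A: "poly A z = k * (z - a) * (z - b) * (z - c) * (z - d)" for z
    by (simp add: A algebra_simps)
  have root: "at_most_regular_singular (\<lambda>z. poly B z / poly A z) (\<lambda>z. poly C z / poly A z) x"
    if A_eq: "\<And>z. poly A z = k * (z - p) * (z - q) * (z - r) * (z - x)" and "x \<notin> {p, q, r}" for x p q r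
  proof (rule at_most_regular_singularI)
    \<comment> \<open>The factor z - x raises the simple pole of C/A to the squared denominator of
      the rule.\<close>
    show "poly B analytic_on {x}" "(\<lambda>z. poly C z * (z - x)) analytic_on {x}"
      "(\<lambda>z. k * (z - p) * (z - q) * (z - r)) analytic_on {x}"
      by (intro analytic_intros)+
    show "k * (x - p) * (x - q) * (x - r) \<noteq> 0"
      using that(2) \<open>k \<noteq> 0\<close> by simp
    show "\<forall>\<^sub>F z in at x. poly C z / poly A z
        = poly C z * (z - x) / (k * (z - p) * (z - q) * (z - r) * (z - x) ^ 2)"
      unfolding A_eq by (simp add: eventually_at_filter power2_eq_square)
  qed (simp add: A_eq)
  have "at_most_regular_singular (\<lambda>z. poly B z / poly A z) (\<lambda>z. poly C z / poly A z) a"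
    by (rule root[of b c d]) (use assms(3) in \<open>auto simp: poly_A\<close>)
  moreover have "at_most_regular_singular (\<lambda>z. poly B z / poly A z) (\<lambda>z. poly C z / poly A z) b"
    by (rule root[of a c d]) (use assms(3) in \<open>auto simp: poly_A\<close>)
  moreover have "at_most_regular_singular (\<lambda>z. poly B z / poly A z) (\<lambda>z. poly C z / poly A z) c"
    by (rule root[of a b d]) (use assms(3) in \<open>auto simp: poly_A\<close>)
  moreover have "at_most_regular_singular (\<lambda>z. poly B z / poly A z) (\<lambda>z. poly C z / poly A z) d"
    by (rule root[of a b c]) (use assms(3) in \<open>auto simp: poly_A\<close>)
  ultimately have roots: "\<forall>x\<in>{a, b, c, d}.
      at_most_regular_singular (\<lambda>z. poly B z / poly A z) (\<lambda>z. poly C z / poly A z) x"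
    by blast
  have at_infinity: "at_most_regular_singular
      (\<lambda>w. 2 / w - poly B (1 / w) / poly A (1 / w) / w ^ 2)
      (\<lambda>w. poly C (1 / w) / poly A (1 / w) / w ^ 4) 0"
  proof -
    \<comment> \<open>Reversed polynomials: w^4 A(1/w), w^3 B(1/w) and w^2 C(1/w), which are regular
      at w = 0.\<close>
    define A' where "A' w = k * (1 - a * w) * (1 - b * w) * (1 - c * w) * (1 - d * w)" for w
    define B' where "B' w = coeff B 3 + coeff B 2 * w + coeff B 1 * w ^ 2 + coeff B 0 * w ^ 3" for w
    define C' where "C' w = coeff C 2 + coeff C 1 * w + coeff C 0 * w ^ 2" for w
    have poly_B: "poly B z = coeff B 0 + coeff B 1 * z + coeff B 2 * z ^ 2 + coeff B 3 * z ^ 3" for z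
      unfolding poly_altdef_degree_le[OF \<open>degree B \<le> 3\<close>] by (simp add: eval_nat_numeral)
    have poly_C: "poly C z = coeff C 0 + coeff C 1 * z + coeff C 2 * z ^ 2" for z
      unfolding poly_altdef_degree_le[OF \<open>degree C \<le> 2\<close>] by (simp add: eval_nat_numeral)
    have inv: "poly A (1 / w) = A' w / w ^ 4" "poly B (1 / w) = B' w / w ^ 3" "poly C (1 / w) = C' w / w ^ 2"
      if "w \<noteq> 0" for w
      using that by (simp_all add: poly_A poly_B poly_C A'_def B'_def C'_def field_simps eval_nat_numeral)
    have A'_an: "A' analytic_on {0}" and "A' 0 \<noteq> 0"
      using \<open>k \<noteq> 0\<close> unfolding A'_def[abs_def] by (auto intro!: analytic_intros)
    then have "\<forall>\<^sub>F w in at 0. A' w \<noteq> 0"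
      using analytic_at_imp_isCont[OF A'_an] by (auto simp: isCont_def intro: tendsto_imp_eventually_ne)
    then have ev: "\<forall>\<^sub>F w in at 0. A' w \<noteq> 0 \<and> w \<noteq> 0"
      by (auto simp: eventually_at_filter elim: eventually_mono)
    show ?thesis
    proof (rule at_most_regular_singularI)
      show "(\<lambda>w. 2 * A' w - B' w) analytic_on {0}" "C' analytic_on {0}"
        unfolding A'_def B'_def C'_def[abs_def] by (auto intro!: analytic_intros)
      show "\<forall>\<^sub>F w in at 0. 2 / w - poly B (1 / w) / poly A (1 / w) / w ^ 2
          = (2 * A' w - B' w) / (A' w * (w - 0))"
        using ev by eventually_elim (simp add: inv field_simps eval_nat_numeral)
      show "\<forall>\<^sub>F w in at 0. poly C (1 / w) / poly A (1 / w) / w ^ 4 = C' w / (A' w * (w - 0) ^ 2)"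
        using ev by eventually_elim (simp add: inv field_simps eval_nat_numeral)
    qed fact+
  qed
  have "poly A z \<noteq> 0" if "z \<in> - {a, b, c, d}" for z
    using that \<open>k \<noteq> 0\<close> by (auto simp: poly_A)
  then have "(\<lambda>z. poly B z / poly A z) analytic_on - {a, b, c, d}"
    "(\<lambda>z. poly C z / poly A z) analytic_on - {a, b, c, d}"
    by (auto intro!: analytic_intros)
  with roots at_infinity show ?thesis
    unfolding fuchsian_equation_def by blast
qed

text \<open>\<open>a\<close> and \<open>b\<close> are the zeros -(7 \<plusminus> 4 sqrt 3) of
  \<open>p_f\<close>, so the set consists of the zeros of 4 u (1 - u) p_f.\<close>

lemma octahedral_ode_fuchsian:
  defines "a \<equiv> - ((2 + of_real (sqrt 3)) ^ 2)" and "b \<equiv> - ((2 - of_real (sqrt 3)) ^ 2)"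
  shows "fuchsian_equation {0, 1, a, b}
    (\<lambda>z. poly (octahedral_ode1 n m) z / poly octahedral_ode2 z)
    (\<lambda>z. poly (octahedral_ode0 n m) z / poly octahedral_ode2 z)"
    and "poly octahedral_ode2 z = 0 \<Longrightarrow> z \<in> {0, 1, a, b}"
proof -
  define s :: complex where "s = of_real (sqrt 3)"
  have s: "s ^ 2 = 3"
    by (simp add: s_def flip: of_real_power)
  have ab: "a = - (7 + 4 * s)" "b = - (7 - 4 * s)"
    using s by (simp_all add: a_def b_def s_def[symmetric] power2_sum power2_diff)
  have A: "octahedral_ode2 = smult (- 4) ([:- 0, 1:] * [:- 1, 1:] * [:- a, 1:] * [:- b, 1:])"
    using s by (simp add: octahedral_ode2_def ab algebra_simps power2_eq_square)
  have r: "a = of_real (- (7 + 4 * sqrt 3))" "b = of_real (- (7 - 4 * sqrt 3))"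
    by (simp_all add: ab s_def)
  have "sqrt 3 > 0" by simp
  \<comment> \<open>(4 sqrt 3)^2 = 48 is neither 49 nor 64, which keeps \<open>b\<close> away from 0
    and 1.\<close>
  have "x \<notin> {7, 8}" if "x ^ 2 = 48" for x :: real
    using that by auto
  from this[of "4 * sqrt 3"] have "4 * sqrt 3 \<notin> {7, 8}"
    by (simp add: power_mult_distrib)
  then have "distinct [0, 1, a, b]"
    by (auto simp: r complex_eq_iff) (use \<open>sqrt 3 > 0\<close> in linarith)+
  then show "fuchsian_equation {0, 1, a, b}
    (\<lambda>z. poly (octahedral_ode1 n m) z / poly octahedral_ode2 z)
    (\<lambda>z. poly (octahedral_ode0 n m) z / poly octahedral_ode2 z)"
    by (intro fuchsian_equation_roots[OF A])
       (auto simp: octahedral_ode1_def octahedral_ode0_def intro!: order.trans[OF degree_smult_le])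
  show "z \<in> {0, 1, a, b}" if "poly octahedral_ode2 z = 0"
    using that unfolding A poly_smult poly_mult mult_eq_0_iff by auto
qed

section \<open>Expansion, degree and Heun property of the octahedral functions\<close>

theorem theorem6p4:
  fixes n m :: int and r :: "complex \<Rightarrow> complex"
  assumes "octahedral_function n m r"
  shows "(\<exists>a :: int \<Rightarrow> complex.
            (\<forall>\<^sub>F u in nhds 0. (\<lambda>k. a (int k) * u ^ k) sums r u) \<and>
            a 0 = 1 \<and> a (- 1) = 0 \<and> a (- 2) = 0 \<and>
            (\<forall>k\<ge>0.
               of_int ((k + 1) * (4 * k - 4 * m + 3)) * a (k + 1)
               + of_int (k * (52 * k - 36 * m - 168 * n - 13)
                         - (2 * m - 9 * n) * (12 * m + 12 * n + 1)) * a k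
               - of_int ((k - 1) * (52 * k - 276 * m - 144 * n - 65)
                         + 2 * (14 * m + 3 * n) * (12 * m + 12 * n + 1)) * a (k - 1)
               - of_int ((k - 2 * m - 3 * n - 2) * (4 * k - 12 * m - 12 * n - 9)) * a (k - 2)
               = 0)) \<and>
         (n \<ge> 0 \<and> m \<ge> 0 \<longrightarrow>
            (\<exists>p :: complex poly.
               (\<forall>u. r u = poly p u) \<and>
               int (degree p) = 3 * n + 2 * m \<and>
               generalized_Heun_polynomial
                 {0, 1, - ((2 + of_real (sqrt 3)) ^ 2), - ((2 - of_real (sqrt 3)) ^ 2)} p))"
proof -
  obtain y where y: "r has_fps_expansion y" "y $ 0 = 1"
    and ode: "fps_of_poly octahedral_ode2 * fps_deriv (fps_deriv y)
         + fps_of_poly (octahedral_ode1 n m) * fps_deriv y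
         + fps_of_poly (octahedral_ode0 n m) * y = 0"
    using octahedral_function_expansion[OF assms] by blast
  define a where "a k = (if k < 0 then 0 else fps_nth y (nat k))" for k :: int
  have a_nat: "a (int k) = fps_nth y k" for k
    by (simp add: a_def)
  have "\<forall>\<^sub>F u in nhds 0. u \<in> eball 0 (fps_conv_radius y)"
    using y(1) by (intro eventually_nhds_in_open) (auto simp: has_fps_expansion_def zero_ereal_def)
  moreover have "\<forall>\<^sub>F u in nhds 0. eval_fps y u = r u"
    using y(1) by (simp add: has_fps_expansion_def)
  ultimately have sums: "\<forall>\<^sub>F u in nhds 0. (\<lambda>k. a (int k) * u ^ k) sums r u"
  proof eventually_elim
    case (elim u)
    then show ?case
      using sums_eval_fps[of u y] by (simp add: a_nat)
  qed
  have recurrence: "of_int ((k + 1) * (4 * k - 4 * m + 3)) * a (k + 1)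
               + of_int (k * (52 * k - 36 * m - 168 * n - 13)
                         - (2 * m - 9 * n) * (12 * m + 12 * n + 1)) * a k
               - of_int ((k - 1) * (52 * k - 276 * m - 144 * n - 65)
                         + 2 * (14 * m + 3 * n) * (12 * m + 12 * n + 1)) * a (k - 1)
               - of_int ((k - 2 * m - 3 * n - 2) * (4 * k - 12 * m - 12 * n - 9)) * a (k - 2)
               = 0" if "k \<ge> 0" for k
    unfolding a_def by (rule octahedral_ode_recurrence[OF ode that])
  show ?thesis
  proof (intro conjI impI)
    show "\<exists>a :: int \<Rightarrow> complex.
            (\<forall>\<^sub>F u in nhds 0. (\<lambda>k. a (int k) * u ^ k) sums r u) \<and>
            a 0 = 1 \<and> a (- 1) = 0 \<and> a (- 2) = 0 \<and>
            (\<forall>k\<ge>0.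
               of_int ((k + 1) * (4 * k - 4 * m + 3)) * a (k + 1)
               + of_int (k * (52 * k - 36 * m - 168 * n - 13)
                         - (2 * m - 9 * n) * (12 * m + 12 * n + 1)) * a k
               - of_int ((k - 1) * (52 * k - 276 * m - 144 * n - 65)
                         + 2 * (14 * m + 3 * n) * (12 * m + 12 * n + 1)) * a (k - 1)
               - of_int ((k - 2 * m - 3 * n - 2) * (4 * k - 12 * m - 12 * n - 9)) * a (k - 2)
               = 0)"
    proof (intro exI[of _ a] conjI allI impI)
      show "a 0 = 1" "a (- 1) = 0" "a (- 2) = 0"
        by (simp_all add: a_def y(2))
    qed (fact sums recurrence)+
  next
    let ?S = "{0, 1, - ((2 + of_real (sqrt 3)) ^ 2), - ((2 - of_real (sqrt 3)) ^ 2)} :: complex set"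
    assume "n \<ge> 0 \<and> m \<ge> 0"
    then obtain p where p: "\<And>u. r u = poly p u"
      using octahedral_function_polynomial[OF assms] by blast
    have "r = poly p"
      using p by (simp add: fun_eq_iff)
    with y(1) have "poly p has_fps_expansion y"
      by simp
    then have y_eq: "y = fps_of_poly p"
      using has_fps_expansion_poly fps_expansion_unique_complex by blast
    have "p \<noteq> 0"
      using y(2) by (auto simp: y_eq)
    let ?d = "int (degree p)"
    txt \<open>At \<open>k = degree p + 2\<close> only the last term of the recurrence survives.\<close>
    have "a (?d + 3) = 0" "a (?d + 2) = 0" "a (?d + 1) = 0" "a ?d = lead_coeff p"
      by (simp_all add: a_def y_eq coeff_eq_0 nat_add_distrib)
    then have "(?d - 2 * m - 3 * n) * (4 * ?d - 12 * m - 12 * n - 1) = 0"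
      using recurrence[of "?d + 2"] \<open>p \<noteq> 0\<close>
      by (simp add: add.assoc algebra_simps del: of_int_mult of_int_add of_int_diff)
    \<comment> \<open>4 (d - 3 m - 3 n) = 1 has no integer solution; this factor belongs to the
      nonintegral exponent at infinity.\<close>
    moreover have "4 * ?d - 12 * m - 12 * n - 1 \<noteq> 0"
      by presburger
    ultimately have degree: "?d = 3 * n + 2 * m"
      by simp
    have p_ode: "octahedral_ode2 * pderiv (pderiv p) + octahedral_ode1 n m * pderiv p
        + octahedral_ode0 n m * p = 0"
    proof -
      have "fps_of_poly (octahedral_ode2 * pderiv (pderiv p) + octahedral_ode1 n m * pderiv p
        + octahedral_ode0 n m * p) = fps_of_poly 0"
        using ode by (simp add: y_eq fps_of_poly_simps fps_of_poly_pderiv)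
      then show ?thesis by (simp only: fps_of_poly_eq_iff)
    qed
    have "generalized_Heun_polynomial ?S p"
      unfolding generalized_Heun_polynomial_def
    proof (intro conjI exI allI impI)
      show "card ?S \<le> 4"
        by (intro order.trans[OF card_insert_le_m1]) auto
      show "poly (pderiv (pderiv p)) z
          + poly (octahedral_ode1 n m) z / poly octahedral_ode2 z * poly (pderiv p) z
          + poly (octahedral_ode0 n m) z / poly octahedral_ode2 z * poly p z = 0"
        if "z \<notin> ?S" for z
      proof -
        have "poly octahedral_ode2 z \<noteq> 0"
          using octahedral_ode_fuchsian(2) that by blast
        then show ?thesis
          using arg_cong[OF p_ode, of "\<lambda>g. poly g z"] by (simp add: field_simps)
      qed
    qed (fact \<open>p \<noteq> 0\<close> octahedral_ode_fuchsian(1))+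
    with p degree show "\<exists>p :: complex poly.
               (\<forall>u. r u = poly p u) \<and>
               int (degree p) = 3 * n + 2 * m \<and>
               generalized_Heun_polynomial ?S p"
      by blast
  qed
qed

end
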